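(* Consider the channel creation game with $N>3$ nodes, blockchain fee $F_B>0$, constant forwarding fee $f_0\ge 0$, and the homogeneous payment scenario with $k\ge 1$ payments from every node to every other node. Consider the star strategy combination: one node (the center) opens a channel to each of the other $N-1$ nodes, and the other nodes open no channels. If $$f_0<\frac{F_B}{k}\cdot\frac{2}{N-1},$$ then the star strategy combination is a Nash equilibrium.
   Context: Channel creation game. The players are the $N$ nodes. Fixed parameters: a blockchain fee $F_B\in\mathbb{R}$, $F_B>0$, a forwarding fee $f_0\ge 0$ that is the same for all nodes, and a payment scenario (a finite multiset of transactions, each with a sender and a different receiver). In the homogeneous payment scenario, for every ordered pair $(s,r)$ of distinct nodes there are exactly $k$ transactions from $s$ to $r$. Strategies: simultaneously and with full information, each node $u$ chooses a set $\mu_u$ of other nodes to which it opens channels; it pays $F_B$ for each channel it opens. Channels are usable in both directions by everyone and have unlimited capital. The strategy combination determines an undirected graph with an edge $\{u,v\}$ whenever $u$ opens a channel to $v$ or $v$ to $u$. Transactions: a route of a transaction is a path in this graph from sender to receiver; a route with $\ell$ edges costs the sender $(\ell-1)f_0$, and each of its $\ell-1$ intermediate nodes receives $f_0$. If the cheapest route costs less than $F_B$, the transaction is executed along a cheapest (shortest) route; if there are several, one is chosen uniformly at random and costs and revenues are taken in expectation. Otherwise (no route of cost less than $F_B$) the transaction is executed on-chain and the sender pays $F_B$. The cost of node $u$ is $|\mu_u|F_B$, plus the fees $u$ pays as sender (off-chain routing fees, and $F_B$ per on-chain transaction), minus the (expected) forwarding revenue of $u$. Each node wants to minimize its cost. A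 (pure) Nash equilibrium is a strategy combination in which no node can strictly decrease its cost by unilaterally changing its strategy. *)

theory Defs
  imports "HOL-Probability.Probability" "Graph_Theory.Graph_Theory"
begin

text \<open>
  A strategy combination on the node set \<open>V\<close> is a function \<open>\<mu>\<close>, where \<open>\<mu> u\<close> is the set of nodes
  to which \<open>u\<close> opens channels. A transaction is a pair (sender, receiver) and a payment scenario
  is a multiset of transactions.
\<close>

definition strategy_set :: "'a set \<Rightarrow> 'a \<Rightarrow> 'a set set" where
  "strategy_set V u = Pow (V - {u})"

text \<open>The undirected channel graph is represented by a symmetric arc relation.\<close>

definition channel_graph :: "'a set \<Rightarrow> ('a \<Rightarrow> 'a set) \<Rightarrow> 'a pair_pre_digraph" where
  "channel_graph V \<mu> =
     \<lparr> pverts = V, parcs = {(u, v). u \<in> V \<and> v \<in> V \<and> (v \<in> \<mu> u \<or> u \<in> \<mu> v)} \<rparr>"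

definition routes :: "'a set \<Rightarrow> ('a \<Rightarrow> 'a set) \<Rightarrow> 'a \<Rightarrow> 'a \<Rightarrow> 'a list set" where
  "routes V \<mu> s r = {p. vpath p (with_proj (channel_graph V \<mu>)) \<and> hd p = s \<and> last p = r}"

definition route_fee :: "real \<Rightarrow> 'a list \<Rightarrow> real" where
  "route_fee f\<^sub>0 p = (real (vwalk_length p) - 1) * f\<^sub>0"

definition intermediate_nodes :: "'a list \<Rightarrow> 'a set" where
  "intermediate_nodes p = set (butlast (tl p))"

text \<open>
  For positive \<open>f\<^sub>0\<close> the cheapest routes are exactly the shortest ones. For \<open>f\<^sub>0 = 0\<close> every route is
  cheapest, but then all routing fees and revenues vanish, so no cost depends on this choice.
\<close>

definition cheapest_routes :: "'a set \<Rightarrow> real \<Rightarrow> ('a \<Rightarrow> 'a set) \<Rightarrow> 'a \<Rightarrow> 'a \<Rightarrow> 'a list set" where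
  "cheapest_routes V f\<^sub>0 \<mu> s r =
     {p. is_arg_min (route_fee f\<^sub>0) (\<lambda>q. q \<in> routes V \<mu> s r) p}"

definition off_chain ::
  "'a set \<Rightarrow> real \<Rightarrow> real \<Rightarrow> ('a \<Rightarrow> 'a set) \<Rightarrow> 'a \<Rightarrow> 'a \<Rightarrow> bool" where
  "off_chain V F\<^sub>B f\<^sub>0 \<mu> s r \<longleftrightarrow> (\<exists>p \<in> cheapest_routes V f\<^sub>0 \<mu> s r. route_fee f\<^sub>0 p < F\<^sub>B)"

definition route_pmf :: "'a set \<Rightarrow> real \<Rightarrow> ('a \<Rightarrow> 'a set) \<Rightarrow> 'a \<Rightarrow> 'a \<Rightarrow> 'a list pmf" where
  "route_pmf V f\<^sub>0 \<mu> s r = pmf_of_set (cheapest_routes V f\<^sub>0 \<mu> s r)"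

definition sender_fee ::
  "'a set \<Rightarrow> real \<Rightarrow> real \<Rightarrow> ('a \<Rightarrow> 'a set) \<Rightarrow> 'a \<Rightarrow> 'a \<Rightarrow> real" where
  "sender_fee V F\<^sub>B f\<^sub>0 \<mu> s r =
     (if off_chain V F\<^sub>B f\<^sub>0 \<mu> s r
      then measure_pmf.expectation (route_pmf V f\<^sub>0 \<mu> s r) (route_fee f\<^sub>0)
      else F\<^sub>B)"

definition forwarding_revenue ::
  "'a set \<Rightarrow> real \<Rightarrow> real \<Rightarrow> ('a \<Rightarrow> 'a set) \<Rightarrow> 'a \<Rightarrow> 'a \<Rightarrow> 'a \<Rightarrow> real" where
  "forwarding_revenue V F\<^sub>B f\<^sub>0 \<mu> u s r =
     (if off_chain V F\<^sub>B f\<^sub>0 \<mu> s r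
      then measure_pmf.expectation (route_pmf V f\<^sub>0 \<mu> s r)
             (\<lambda>p. if u \<in> intermediate_nodes p then f\<^sub>0 else 0)
      else 0)"

definition node_cost ::
  "'a set \<Rightarrow> real \<Rightarrow> real \<Rightarrow> ('a \<times> 'a) multiset \<Rightarrow> ('a \<Rightarrow> 'a set) \<Rightarrow> 'a \<Rightarrow> real" where
  "node_cost V F\<^sub>B f\<^sub>0 T \<mu> u =
     real (card (\<mu> u)) * F\<^sub>B
     + (\<Sum>(s, r)\<in>#filter_mset (\<lambda>(s, r). s = u) T. sender_fee V F\<^sub>B f\<^sub>0 \<mu> s r)
     - (\<Sum>(s, r)\<in>#T. forwarding_revenue V F\<^sub>B f\<^sub>0 \<mu> u s r)"

definition nash_equilibrium ::
  "'a set \<Rightarrow> real \<Rightarrow> real \<Rightarrow> ('a \<times> 'a) multiset \<Rightarrow> ('a \<Rightarrow> 'a set) \<Rightarrow> bool" where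
  "nash_equilibrium V F\<^sub>B f\<^sub>0 T \<mu> \<longleftrightarrow>
     (\<forall>u\<in>V. \<mu> u \<in> strategy_set V u) \<and>
     (\<forall>u\<in>V. \<forall>A\<in>strategy_set V u.
        \<not> node_cost V F\<^sub>B f\<^sub>0 T (\<mu>(u := A)) u < node_cost V F\<^sub>B f\<^sub>0 T \<mu> u)"

definition homogeneous_scenario :: "'a set \<Rightarrow> nat \<Rightarrow> ('a \<times> 'a) multiset" where
  "homogeneous_scenario V k =
     repeat_mset k (mset_set {(s, r). s \<in> V \<and> r \<in> V \<and> s \<noteq> r})"

definition star_strategy :: "'a set \<Rightarrow> 'a \<Rightarrow> 'a \<Rightarrow> 'a set" where
  "star_strategy V c u = (if u = c then V - {c} else {})"

end

theory Submission
  imports Defs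
begin

text \<open>
  A leaf that opens channels to \<open>b\<close> further leaves saves the fee \<open>f\<^sub>0\<close> for payments to each of
  them and shares the traffic between them evenly with the center, which earns it
  \<open>b (b - 1) f\<^sub>0 / 2\<close>. The total gain \<open>k f\<^sub>0 b (b + 1) / 2\<close> does not exceed the price
  \<open>b F\<^sub>B\<close> because \<open>b + 1 \<le> N - 1\<close>. The center that drops a channel saves \<open>F\<^sub>B\<close> but pays
  \<open>k F\<^sub>B\<close> on-chain and loses revenue.
\<close>

section \<open>Channels and the shape of routes\<close>

text \<open>The arc relation of \<open>channel_graph\<close> as a plain predicate, so that routes
  can be handled as lists.\<close>

definition channel :: "'a set \<Rightarrow> ('a \<Rightarrow> 'a set) \<Rightarrow> 'a \<Rightarrow> 'a \<Rightarrow> bool" where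
  "channel V \<mu> x y \<longleftrightarrow> x \<in> V \<and> y \<in> V \<and> (y \<in> \<mu> x \<or> x \<in> \<mu> y)"

text \<open>The candidates for the middle node of a two-edge route. A node with a channel to itself
  could be counted as its own neighbour; \<open>not_loop\<close> later excludes this for
  \<open>s\<close> and \<open>r\<close>.\<close>

definition common_neighbours :: "'a set \<Rightarrow> ('a \<Rightarrow> 'a set) \<Rightarrow> 'a \<Rightarrow> 'a \<Rightarrow> 'a set" where
  "common_neighbours V \<mu> s r = {w. channel V \<mu> s w \<and> channel V \<mu> w r}"

lemma mem_routes_iff:
  "p \<in> routes V \<mu> s r \<longleftrightarrow>
     p \<noteq> [] \<and> set p \<subseteq> V \<and> (\<forall>(x, y) \<in> set (vwalk_arcs p). channel V \<mu> x y) \<and> distinct p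
     \<and> hd p = s \<and> last p = r"
  unfolding routes_def vpath_def vwalk_def channel_graph_def channel_def by auto

text \<open>Only routes with one or two edges have to be known exactly. For a longer one, the bound
  on its length gives the fee comparison, and the channels at its two ends suffice to show when no
  route exists.\<close>

lemma route_cases:
  assumes "p \<in> routes V \<mu> s r" and "s \<noteq> r"
  obtains (direct) "p = [s, r]" and "channel V \<mu> s r"
  | (two_hop) w where "p = [s, w, r]" and "w \<in> common_neighbours V \<mu> s r"
  | (long) "length p > 3" and "\<exists>w. channel V \<mu> s w" and "\<exists>w. channel V \<mu> w r"
proof -
  from assms obtain x q where p: "p = s # x # q"
    unfolding mem_routes_iff by (cases p; cases "tl p") auto
  have first: "channel V \<mu> s x"
    using assms(1) unfolding p mem_routes_iff by auto
  show thesis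
  proof (cases q)
    case Nil
    with assms(1) p first direct show thesis by (auto simp: mem_routes_iff)
  next
    case (Cons y q')
    show thesis
    proof (cases q')
      case Nil
      with assms(1) p Cons two_hop show thesis
        by (auto simp: mem_routes_iff common_neighbours_def)
    next
      case (Cons z q'')
      \<comment> \<open>Splitting off the last two nodes exposes the final arc, which enters
        \<open>r\<close>.\<close>
      have *: "p = butlast p @ [r]" "butlast p = butlast (butlast p) @ [last (butlast p)]"
        using assms(1) p \<open>q = y # q'\<close> by (auto simp: mem_routes_iff)
      have "(last (butlast p), r) \<in> set (vwalk_arcs p)"
        by (subst *(1), subst vwalk_arcs_append) (use p in auto)
      with assms(1) have "channel V \<mu> (last (butlast p)) r"
        by (auto simp: mem_routes_iff)
      with long p first \<open>q = y # q'\<close> Cons show thesis by auto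
    qed
  qed
qed

lemma route_fee_eq: "p \<noteq> [] \<Longrightarrow> route_fee f p = (real (length p) - 2) * f"
  by (cases p) (auto simp: route_fee_def)

lemma mem_cheapest_routes_iff:
  "p \<in> cheapest_routes V f \<mu> s r \<longleftrightarrow>
     p \<in> routes V \<mu> s r \<and> (\<forall>q \<in> routes V \<mu> s r. route_fee f p \<le> route_fee f q)"
  unfolding cheapest_routes_def is_arg_min_linorder by auto

section \<open>Fees and revenue of a transaction with a direct channel or without a route\<close>

context
  fixes V :: "'a set" and F f :: real and \<mu> :: "'a \<Rightarrow> 'a set" and s r :: 'a
  assumes F_pos: "F > 0" and f_nonneg: "f \<ge> 0" and s_neq_r: "s \<noteq> r"
begin

lemma route_nonempty: "p \<in> routes V \<mu> s r \<Longrightarrow> p \<noteq> []"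
  by (simp add: mem_routes_iff)

lemma channel_route: "channel V \<mu> s r \<Longrightarrow> [s, r] \<in> routes V \<mu> s r"
  using s_neq_r by (auto simp: mem_routes_iff channel_def)

lemma route_fee_nonneg: "p \<in> routes V \<mu> s r \<Longrightarrow> route_fee f p \<ge> 0"
  using s_neq_r by (auto elim!: route_cases simp: route_fee_def f_nonneg)

lemma channel_cheapest:
  assumes "channel V \<mu> s r"
  shows "[s, r] \<in> cheapest_routes V f \<mu> s r"
  using channel_route[OF assms] route_fee_nonneg
  by (auto simp: mem_cheapest_routes_iff route_fee_eq)

lemma channel_off_chain:
  assumes "channel V \<mu> s r"
  shows "off_chain V F f \<mu> s r"
  unfolding off_chain_def using channel_cheapest[OF assms] F_pos
  by (intro bexI[of _ "[s, r]"]) (auto simp: route_fee_eq)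

text \<open>The direct route is free, and with a positive fee every intermediate node makes a route
  strictly dearer. For \<open>f = 0\<close> all routes tie.\<close>

lemma channel_cheapest_routes:
  assumes "channel V \<mu> s r" and "f > 0"
  shows "cheapest_routes V f \<mu> s r = {[s, r]}"
proof -
  have "p = [s, r]" if "p \<in> cheapest_routes V f \<mu> s r" for p
  proof -
    have p: "p \<in> routes V \<mu> s r" "route_fee f p \<le> route_fee f [s, r]"
      using that channel_route[OF assms(1)] by (auto simp: mem_cheapest_routes_iff)
    have "(real (length p) - 2) * f \<le> 0"
      using p by (simp add: route_fee_eq route_nonempty)
    then have "length p \<le> 2" using assms(2) by (simp add: mult_le_0_iff)
    with p(1) s_neq_r show ?thesis by (elim route_cases) auto
  qed
  with channel_cheapest[OF assms(1)] show ?thesis by blast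
qed

text \<open>For \<open>f = 0\<close> the set of cheapest routes can contain routes of any length,
  but the expectations vanish under every distribution. This settles the case \<open>f = 0\<close>
  of each fee computation, leaving \<open>f > 0\<close> for the exact sets of cheapest
  routes.\<close>

lemma zero_fee_expectations:
  assumes "f = 0"
  shows "measure_pmf.expectation M (route_fee f) = 0"
    and "measure_pmf.expectation M (\<lambda>p. if u \<in> intermediate_nodes p then f else 0) = 0"
  unfolding assms by (simp_all add: route_fee_def [abs_def])

lemma sender_fee_channel:
  assumes "channel V \<mu> s r"
  shows "sender_fee V F f \<mu> s r = 0"
proof (cases "f = 0")
  case False
  with f_nonneg have "f > 0" by simp
  with channel_off_chain[OF assms] channel_cheapest_routes[OF assms] show ?thesis
    by (simp add: sender_fee_def route_pmf_def pmf_of_set_singleton route_fee_eq)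
qed (use channel_off_chain[OF assms] zero_fee_expectations in \<open>simp add: sender_fee_def\<close>)

lemma forwarding_revenue_channel:
  assumes "channel V \<mu> s r"
  shows "forwarding_revenue V F f \<mu> u s r = 0"
proof (cases "f = 0")
  case False
  with f_nonneg have "f > 0" by simp
  with channel_off_chain[OF assms] channel_cheapest_routes[OF assms] show ?thesis
    by (simp add: forwarding_revenue_def route_pmf_def pmf_of_set_singleton intermediate_nodes_def)
qed (use channel_off_chain[OF assms] zero_fee_expectations in \<open>simp add: forwarding_revenue_def\<close>)

lemma no_route:
  assumes "(\<forall>w. \<not> channel V \<mu> s w) \<or> (\<forall>w. \<not> channel V \<mu> w r)"
  shows "\<not> off_chain V F f \<mu> s r"
proof -
  have "routes V \<mu> s r = {}"
  proof (rule equals0I)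
    fix p assume "p \<in> routes V \<mu> s r"
    then show False
      using s_neq_r by (rule route_cases) (use assms in \<open>auto simp: common_neighbours_def\<close>)
  qed
  then show ?thesis by (auto simp: off_chain_def mem_cheapest_routes_iff)
qed

section \<open>Fees and revenue of a transaction over common neighbours\<close>

context
  assumes f_less: "f < F" and not_channel: "\<not> channel V \<mu> s r"
    and not_loop: "\<not> channel V \<mu> s s" "\<not> channel V \<mu> r r"
    and common: "common_neighbours V \<mu> s r \<noteq> {}"
begin

lemma two_hop_route:
  "w \<in> common_neighbours V \<mu> s r \<Longrightarrow> [s, w, r] \<in> routes V \<mu> s r"
  using s_neq_r not_loop by (auto simp: mem_routes_iff common_neighbours_def channel_def)

lemma two_hop_fee_le:
  assumes "p \<in> routes V \<mu> s r"
  shows "f \<le> route_fee f p"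
  using assms s_neq_r
proof (cases rule: route_cases)
  case long
  with f_nonneg mult_right_mono[of 1 "real (length p) - 2" f] show ?thesis
    by (subst route_fee_eq) auto
qed (use not_channel in \<open>auto simp: route_fee_eq\<close>)

lemma two_hop_cheapest:
  "w \<in> common_neighbours V \<mu> s r \<Longrightarrow> [s, w, r] \<in> cheapest_routes V f \<mu> s r"
  using two_hop_route two_hop_fee_le by (auto simp: mem_cheapest_routes_iff route_fee_eq)

lemma two_hop_off_chain: "off_chain V F f \<mu> s r"
proof -
  from common obtain w where "w \<in> common_neighbours V \<mu> s r" by auto
  from two_hop_cheapest[OF this] f_less show ?thesis
    unfolding off_chain_def by (intro bexI[of _ "[s, w, r]"]) (auto simp: route_fee_eq)
qed

text \<open>Without a direct channel a route has at least one intermediate node, and a second one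
  would raise its fee to at least \<open>2 * f\<close>.\<close>

lemma two_hop_cheapest_routes:
  assumes "f > 0"
  shows "cheapest_routes V f \<mu> s r = (\<lambda>w. [s, w, r]) ` common_neighbours V \<mu> s r"
proof -
  from common obtain w where w: "w \<in> common_neighbours V \<mu> s r" by auto
  have "p \<in> (\<lambda>w. [s, w, r]) ` common_neighbours V \<mu> s r"
    if "p \<in> cheapest_routes V f \<mu> s r" for p
  proof -
    have p: "p \<in> routes V \<mu> s r" "route_fee f p \<le> route_fee f [s, w, r]"
      using that two_hop_route[OF w] by (auto simp: mem_cheapest_routes_iff)
    have "(real (length p) - 2) * f \<le> 1 * f"
      using p by (simp add: route_fee_eq route_nonempty)
    then have "length p \<le> 3" using assms by (simp only: mult_le_cancel_right) auto
    with p(1) s_neq_r not_channel show ?thesis by (elim route_cases) auto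
  qed
  with two_hop_cheapest show ?thesis by blast
qed

lemma finite_common_neighbours: "finite V \<Longrightarrow> finite (common_neighbours V \<mu> s r)"
  by (rule finite_subset[of _ V]) (auto simp: common_neighbours_def channel_def)

lemma sender_fee_two_hop:
  assumes "finite V"
  shows "sender_fee V F f \<mu> s r = f"
proof (cases "f = 0")
  case True
  with two_hop_off_chain zero_fee_expectations show ?thesis by (simp add: sender_fee_def)
next
  case False
  with f_nonneg have "f > 0" by simp
  note routes = two_hop_cheapest_routes[OF this]
  have "measure_pmf.expectation (route_pmf V f \<mu> s r) (route_fee f)
      = (\<Sum>p\<in>cheapest_routes V f \<mu> s r. route_fee f p) / real (card (cheapest_routes V f \<mu> s r))"
    unfolding route_pmf_def
    by (rule integral_pmf_of_set) (use common finite_common_neighbours[OF assms] routes in auto)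
  also have "(\<Sum>p\<in>cheapest_routes V f \<mu> s r. route_fee f p)
      = (\<Sum>p\<in>cheapest_routes V f \<mu> s r. f)"
    by (rule sum.cong) (auto simp: routes route_fee_eq)
  finally show ?thesis
    using common finite_common_neighbours[OF assms] routes two_hop_off_chain
    by (simp add: sender_fee_def card_eq_0_iff)
qed

text \<open>The cheapest routes correspond to their middle nodes, so the uniform choice of a route
  is a uniform choice of a common neighbour.\<close>

lemma forwarding_revenue_two_hop:
  assumes "finite V"
  shows "forwarding_revenue V F f \<mu> u s r
    = (if u \<in> common_neighbours V \<mu> s r then f / real (card (common_neighbours V \<mu> s r)) else 0)"
proof (cases "f = 0")
  case True
  with two_hop_off_chain zero_fee_expectations show ?thesis by (simp add: forwarding_revenue_def)
next
  case False
  with f_nonneg have "f > 0" by simp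
  note routes = two_hop_cheapest_routes[OF this]
  have inj: "inj_on (\<lambda>w. [s, w, r]) (common_neighbours V \<mu> s r)"
    by (auto simp: inj_on_def)
  let ?rev = "\<lambda>p. if u \<in> intermediate_nodes p then f else 0"
  have "measure_pmf.expectation (route_pmf V f \<mu> s r) ?rev
      = (\<Sum>p\<in>cheapest_routes V f \<mu> s r. ?rev p) / real (card (cheapest_routes V f \<mu> s r))"
    unfolding route_pmf_def
    by (rule integral_pmf_of_set) (use common finite_common_neighbours[OF assms] routes in auto)
  also have "card (cheapest_routes V f \<mu> s r) = card (common_neighbours V \<mu> s r)"
    by (simp add: routes card_image inj)
  also have "(\<Sum>p\<in>cheapest_routes V f \<mu> s r. ?rev p)
      = (\<Sum>w\<in>common_neighbours V \<mu> s r. if u = w then f else 0)"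
    by (simp add: routes sum.reindex[OF inj] intermediate_nodes_def)
  finally show ?thesis
    using finite_common_neighbours[OF assms] two_hop_off_chain
    by (simp add: forwarding_revenue_def)
qed

end

end

section \<open>Sums over the homogeneous scenario\<close>

lemma sum_mset_repeat_mset:
  fixes g :: "'b \<Rightarrow> real"
  shows "(\<Sum>x\<in>#repeat_mset k M. g x) = real k * (\<Sum>x\<in>#M. g x)"
  by (induction k) (auto simp: algebra_simps)

lemma filter_repeat_mset: "filter_mset P (repeat_mset k M) = repeat_mset k (filter_mset P M)"
  by (induction k) auto

lemma node_cost_homogeneous:
  assumes "finite V" and "u \<in> V"
  shows "node_cost V F f (homogeneous_scenario V k) \<mu> u
    = real (card (\<mu> u)) * F + real k * (\<Sum>r\<in>V - {u}. sender_fee V F f \<mu> u r)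
      - real k * (\<Sum>(s, r)\<in>{(s, r). s \<in> V \<and> r \<in> V \<and> s \<noteq> r}. forwarding_revenue V F f \<mu> u s r)"
proof -
  let ?P = "{(s, r). s \<in> V \<and> r \<in> V \<and> s \<noteq> r}"
  have fin: "finite ?P"
    by (rule finite_subset[of _ "V \<times> V"]) (use assms in auto)
  have "{x \<in> ?P. case x of (s, r) \<Rightarrow> s = u} = Pair u ` (V - {u})"
    using assms(2) by auto
  then have "filter_mset (\<lambda>(s, r). s = u) (mset_set ?P) = mset_set (Pair u ` (V - {u}))"
    using fin by simp
  then have "(\<Sum>(s, r)\<in>#filter_mset (\<lambda>(s, r). s = u) (homogeneous_scenario V k). sender_fee V F f \<mu> s r)
      = real k * (\<Sum>(s, r)\<in>Pair u ` (V - {u}). sender_fee V F f \<mu> s r)"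
    by (simp only: homogeneous_scenario_def filter_repeat_mset sum_mset_repeat_mset
        sum_unfold_sum_mset)
  also have "\<dots> = real k * (\<Sum>r\<in>V - {u}. sender_fee V F f \<mu> u r)"
    by (simp add: sum.reindex inj_on_def)
  finally show ?thesis
    by (simp add: node_cost_def homogeneous_scenario_def sum_mset_repeat_mset sum_unfold_sum_mset)
qed

lemma card_off_diagonal:
  assumes "finite B"
  shows "real (card {(s, r). s \<in> B \<and> r \<in> B \<and> s \<noteq> r}) = real (card B) * (real (card B) - 1)"
proof -
  have "{(s, r). s \<in> B \<and> r \<in> B \<and> s \<noteq> r} = B \<times> B - (\<lambda>x. (x, x)) ` B"
    by auto
  moreover have "card (B \<times> B - (\<lambda>x. (x, x)) ` B) = card B * card B - card B"
    using assms by (subst card_Diff_subset) (auto simp: card_cartesian_product card_image inj_on_def)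
  \<comment> \<open>Makes the natural-number subtraction exact, so that it can be carried over to
    the reals.\<close>
  moreover have "card B \<le> card B * card B"
    by (cases "card B") auto
  ultimately show ?thesis by (simp add: of_nat_diff algebra_simps)
qed

text \<open>Meant for forwarding revenue: \<open>B\<close> holds the nodes whose mutual payments can
  pass through the deviating node, and \<open>a\<close> is its expected income per payment.\<close>

lemma sum_off_diagonal_indicator:
  assumes "finite V" and "B \<subseteq> V"
    and "\<And>s r. s \<in> V \<Longrightarrow> r \<in> V \<Longrightarrow> s \<noteq> r \<Longrightarrow> g s r = (if s \<in> B \<and> r \<in> B then a else 0)"
  shows "(\<Sum>(s, r)\<in>{(s, r). s \<in> V \<and> r \<in> V \<and> s \<noteq> r}. g s r)
    = real (card B) * (real (card B) - 1) * a"
proof -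
  let ?P = "\<lambda>X. {(s, r). s \<in> X \<and> r \<in> X \<and> s \<noteq> r}"
  have fin: "finite (?P V)"
    by (rule finite_subset[of _ "V \<times> V"]) (use assms in auto)
  have "(\<Sum>(s, r)\<in>?P V. g s r) = (\<Sum>(s, r)\<in>?P B. a)"
    by (rule sum.mono_neutral_cong_right[OF fin]) (use assms in \<open>auto simp: subset_iff split: if_splits\<close>)
  also have "\<dots> = real (card (?P B)) * a"
    by simp
  finally show ?thesis
    using card_off_diagonal[of B] finite_subset[OF assms(2,1)] by simp
qed

text \<open>Meant for sender fees: \<open>B\<close> holds the receivers that are reached free of
  charge.\<close>

lemma sum_subset_indicator:
  fixes a :: real
  assumes "finite V" and "B \<subseteq> V" and "\<And>x. x \<in> V \<Longrightarrow> g x = (if x \<in> B then 0 else a)"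
  shows "(\<Sum>x\<in>V. g x) = (real (card V) - real (card B)) * a"
proof -
  have "(\<Sum>x\<in>V. g x) = (\<Sum>x\<in>V - B. a)"
    by (rule sum.mono_neutral_cong_right) (use assms in auto)
  also have "\<dots> = (real (card V) - real (card B)) * a"
    using assms card_mono[OF assms(1,2)] by (simp add: card_Diff_subset finite_subset of_nat_diff)
  finally show ?thesis .
qed

section \<open>Costs of the center and of a leaf after a deviation\<close>

context
  fixes V :: "'a set" and c :: 'a and F f :: real
  assumes finite_V: "finite V" and c_in: "c \<in> V"
    and F_pos: "F > 0" and f_nonneg: "f \<ge> 0" and f_less: "f < F"
begin

text \<open>The deviation leaves a star on \<open>c\<close> and \<open>A\<close>, with all other
  nodes isolated. The center pays on-chain for each isolated receiver and forwards every payment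
  between two nodes of \<open>A\<close>. The choice \<open>A = V - {c}\<close> is the original
  star.\<close>

lemma center_cost:
  assumes "A \<subseteq> V - {c}"
  shows "node_cost V F f (homogeneous_scenario V k) ((star_strategy V c)(c := A)) c
    = real (card A) * F + real k * (real (card V) - 1 - real (card A)) * F
      - real k * (real (card A) * (real (card A) - 1) * f)"
proof -
  define \<mu> where "\<mu> = (star_strategy V c)(c := A)"
  have channel: "channel V \<mu> x y \<longleftrightarrow> (x = c \<and> y \<in> A \<or> y = c \<and> x \<in> A)" for x y
    using assms c_in by (auto simp: channel_def \<mu>_def star_strategy_def)
  have fee: "sender_fee V F f \<mu> c r = (if r \<in> A then 0 else F)" if "r \<in> V - {c}" for r
  proof (cases "r \<in> A")
    case True
    with that F_pos f_nonneg show ?thesis by (auto intro!: sender_fee_channel simp: channel)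
  next
    case False
    with that have "\<not> off_chain V F f \<mu> c r"
      using F_pos f_nonneg by (intro no_route) (auto simp: channel)
    with False show ?thesis by (simp add: sender_fee_def)
  qed
  have rev: "forwarding_revenue V F f \<mu> c s r = (if s \<in> A \<and> r \<in> A then f else 0)"
    if "s \<in> V" "r \<in> V" "s \<noteq> r" for s r
  proof -
    consider "channel V \<mu> s r" | "s \<in> A" "r \<in> A" | "s \<noteq> c" "s \<notin> A" | "r \<noteq> c" "r \<notin> A"
      using \<open>s \<noteq> r\<close> by (auto simp: channel)
    then show ?thesis
    proof cases
      case 1
      then show ?thesis
        using that F_pos f_nonneg assms by (subst forwarding_revenue_channel) (auto simp: channel)
    next
      case 2
      then have "common_neighbours V \<mu> s r = {c}"
        using assms by (auto simp: common_neighbours_def channel)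
      with 2 show ?thesis
        using that F_pos f_nonneg f_less finite_V assms
        by (subst forwarding_revenue_two_hop) (auto simp: channel)
    next
      case 3
      then have "\<not> off_chain V F f \<mu> s r"
        using that F_pos f_nonneg by (intro no_route) (auto simp: channel)
      with 3 show ?thesis by (simp add: forwarding_revenue_def)
    next
      case 4
      then have "\<not> off_chain V F f \<mu> s r"
        using that F_pos f_nonneg by (intro no_route) (auto simp: channel)
      with 4 show ?thesis by (simp add: forwarding_revenue_def)
    qed
  qed
  have "card V \<ge> 1" using finite_V c_in by (simp add: Suc_le_eq card_gt_0_iff) blast
  then have "(\<Sum>r\<in>V - {c}. sender_fee V F f \<mu> c r) = (real (card V) - 1 - real (card A)) * F"
    using sum_subset_indicator[OF _ assms fee] finite_V c_in by (simp add: of_nat_diff)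
  moreover have "(\<Sum>(s, r)\<in>{(s, r). s \<in> V \<and> r \<in> V \<and> s \<noteq> r}. forwarding_revenue V F f \<mu> c s r)
      = real (card A) * (real (card A) - 1) * f"
    by (rule sum_off_diagonal_indicator[OF finite_V _ rev]) (use assms in auto)
  ultimately show ?thesis
    using node_cost_homogeneous[OF finite_V c_in, of F f k \<mu>] by (simp add: \<mu>_def)
qed

text \<open>The channel to \<open>c\<close> exists already, so \<open>b\<close> counts only the
  other leaves in \<open>A\<close>. They and \<open>c\<close> are reached for free, and the
  remaining leaves through \<open>c\<close> at fee \<open>f\<close>. A payment between two of the
  \<open>b\<close> leaves without a channel passes through \<open>c\<close> or \<open>u\<close> with
  equal probability, hence \<open>f / 2\<close>.\<close>

lemma leaf_cost:
  assumes "u \<in> V" and "u \<noteq> c" and "A \<subseteq> V - {u}"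
  defines "b \<equiv> real (card (A - {c}))"
  shows "node_cost V F f (homogeneous_scenario V k) ((star_strategy V c)(u := A)) u
    = real (card A) * F + real k * ((real (card V) - 2 - b) * f) - real k * (b * (b - 1) * (f / 2))"
proof -
  define \<mu> where "\<mu> = (star_strategy V c)(u := A)"
  have channel: "channel V \<mu> x y \<longleftrightarrow>
      x \<in> V \<and> y \<in> V \<and> x \<noteq> y \<and> (x = c \<or> y = c \<or> x = u \<and> y \<in> A \<or> y = u \<and> x \<in> A)" for x y
    using assms c_in by (auto simp: channel_def \<mu>_def star_strategy_def)
  \<comment> \<open>The set is written as a disjoint insertion so that its size is
    \<open>b + 1\<close> whether or not \<open>c\<close> lies in \<open>A\<close>.\<close>
  have fee: "sender_fee V F f \<mu> u r = (if r \<in> insert c (A - {c}) then 0 else f)"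
    if "r \<in> V - {u}" for r
  proof (cases "r \<in> insert c A")
    case True
    with that F_pos f_nonneg assms c_in show ?thesis
      by (subst sender_fee_channel) (auto simp: channel)
  next
    case False
    then have "c \<in> common_neighbours V \<mu> u r"
      using that assms c_in by (auto simp: common_neighbours_def channel)
    with False that F_pos f_nonneg f_less assms finite_V show ?thesis
      by (subst sender_fee_two_hop) (auto simp: channel)
  qed
  have rev: "forwarding_revenue V F f \<mu> u s r
      = (if s \<in> A - {c} \<and> r \<in> A - {c} then f / 2 else 0)"
    if "s \<in> V" "r \<in> V" "s \<noteq> r" for s r
  proof (cases "channel V \<mu> s r")
    case True
    then show ?thesis
      using that F_pos f_nonneg assms by (subst forwarding_revenue_channel) (auto simp: channel)
  next
    case False
    then have "s \<noteq> c" "r \<noteq> c" using that by (auto simp: channel)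
    \<comment> \<open>The center is adjacent to both ends, and \<open>u\<close> joins it exactly
      when both ends lie in \<open>A\<close>. If \<open>u\<close> is itself an end, it is not in
      \<open>A\<close>, and only \<open>c\<close> remains.\<close>
    then have common: "common_neighbours V \<mu> s r = (if s \<in> A \<and> r \<in> A then {c, u} else {c})"
      using that assms c_in False by (auto simp: common_neighbours_def channel)
    with False that F_pos f_nonneg f_less finite_V have
      "forwarding_revenue V F f \<mu> u s r = (if u \<in> common_neighbours V \<mu> s r
        then f / real (card (common_neighbours V \<mu> s r)) else 0)"
      by (intro forwarding_revenue_two_hop) (auto simp: channel)
    with common \<open>s \<noteq> c\<close> \<open>r \<noteq> c\<close> assms(2) show ?thesis by auto
  qed
  have "card V \<ge> 1" using finite_V c_in by (simp add: Suc_le_eq card_gt_0_iff) blast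
  moreover have "(\<Sum>r\<in>V - {u}. sender_fee V F f \<mu> u r)
      = (real (card (V - {u})) - real (card (insert c (A - {c})))) * f"
    by (rule sum_subset_indicator[OF _ _ fee]) (use assms finite_V c_in in auto)
  moreover have "finite (A - {c})"
    using assms(3) finite_V by (auto intro: finite_subset)
  then have "real (card (insert c (A - {c}))) = b + 1"
    unfolding b_def by (subst card_insert_disjoint) auto
  ultimately have "(\<Sum>r\<in>V - {u}. sender_fee V F f \<mu> u r) = (real (card V) - 2 - b) * f"
    using finite_V assms(1) by (simp add: of_nat_diff)
  moreover have "(\<Sum>(s, r)\<in>{(s, r). s \<in> V \<and> r \<in> V \<and> s \<noteq> r}. forwarding_revenue V F f \<mu> u s r)
      = b * (b - 1) * (f / 2)"
    unfolding b_def by (rule sum_off_diagonal_indicator[OF finite_V _ rev]) (use assms in auto)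
  ultimately show ?thesis
    using node_cost_homogeneous[OF finite_V assms(1), of F f k \<mu>] by (simp add: \<mu>_def)
qed

end

section \<open>Stability of the star\<close>

theorem mainTheorem2:
  fixes V :: "'a set" and c :: 'a and N k :: nat and F\<^sub>B f\<^sub>0 :: real
  assumes "finite V" and "card V = N" and "N > 3"
    and "c \<in> V"
    and "F\<^sub>B > 0" and "f\<^sub>0 \<ge> 0" and "k \<ge> 1"
    and "f\<^sub>0 < F\<^sub>B / real k * (2 / (real N - 1))"
  shows "nash_equilibrium V F\<^sub>B f\<^sub>0 (homogeneous_scenario V k) (star_strategy V c)"
proof -
  have N: "real N \<ge> 4" and k: "real k \<ge> 1" using assms by auto
  have bound: "real k * f\<^sub>0 * (real N - 1) < 2 * F\<^sub>B"
    using assms(8) N k by (simp add: field_simps)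
  \<comment> \<open>Since \<open>N - 1\<close> is at least 3, the hypothesis bounds
    \<open>f\<^sub>0\<close> by two thirds of \<open>F\<^sub>B\<close>. Two-edge routes are thus
    cheaper than on-chain payment, as both cost formulas require.\<close>
  have "f\<^sub>0 * 3 \<le> real k * f\<^sub>0 * (real N - 1)"
    by (rule mult_mono) (use N k assms(6) mult_right_mono[of 1 "real k" f\<^sub>0] in auto)
  with bound have less: "f\<^sub>0 < F\<^sub>B" using assms(5,6) by linarith
  note center = center_cost[OF assms(1,4,5,6) less] and leaf = leaf_cost[OF assms(1,4,5,6) less]
  have center_stable: "node_cost V F\<^sub>B f\<^sub>0 (homogeneous_scenario V k) (star_strategy V c) c
      \<le> node_cost V F\<^sub>B f\<^sub>0 (homogeneous_scenario V k) ((star_strategy V c)(c := A)) c"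
    if A: "A \<subseteq> V - {c}" for A
  proof -
    define a where "a = real (card A)"
    have "card A \<le> card (V - {c})"
      using A assms(1) by (intro card_mono) auto
    then have a: "0 \<le> a" "a \<le> real N - 1"
      using assms(1-4) by (auto simp: a_def)
    have star: "(star_strategy V c)(c := V - {c}) = star_strategy V c"
      by (simp add: fun_eq_iff star_strategy_def)
    have "real (card (V - {c})) = real N - 1"
      using assms(1-4) by (simp add: of_nat_diff)
    with center[of "V - {c}" k] star assms(2)
    have 1: "node_cost V F\<^sub>B f\<^sub>0 (homogeneous_scenario V k) (star_strategy V c) c
        = (real N - 1) * F\<^sub>B - real k * ((real N - 1) * (real N - 1 - 1) * f\<^sub>0)"
      by simp
    \<comment> \<open>The product is monotone only where both factors are nonnegative; for
      \<open>a < 1\<close> it is at most zero.\<close>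
    have "a * (a - 1) \<le> (real N - 1) * (real N - 1 - 1)"
    proof (cases "a \<ge> 1")
      case True
      with a show ?thesis by (intro mult_mono) auto
    next
      case False
      with a N have "a * (a - 1) \<le> 0" "0 \<le> (real N - 1) * (real N - 1 - 1)"
        by (auto simp: mult_le_0_iff)
      then show ?thesis by linarith
    qed
    then have "real k * (a * (a - 1) * f\<^sub>0) \<le> real k * ((real N - 1) * (real N - 1 - 1) * f\<^sub>0)"
      using assms(6) by (intro mult_left_mono mult_right_mono) auto
    \<comment> \<open>Each dropped channel saves one \<open>F\<^sub>B\<close> but forces
      \<open>k\<close> on-chain payments, and \<open>k\<close> is at least 1.\<close>
    moreover have "1 * ((real N - 1 - a) * F\<^sub>B) \<le> real k * ((real N - 1 - a) * F\<^sub>B)"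
      using k a assms(5) by (intro mult_right_mono) auto
    ultimately show ?thesis
      unfolding 1 center[OF A] assms(2) a_def[symmetric] by (simp add: algebra_simps)
  qed
  have leaf_stable: "node_cost V F\<^sub>B f\<^sub>0 (homogeneous_scenario V k) (star_strategy V c) u
      \<le> node_cost V F\<^sub>B f\<^sub>0 (homogeneous_scenario V k) ((star_strategy V c)(u := A)) u"
    if u: "u \<in> V" "u \<noteq> c" and A: "A \<subseteq> V - {u}" for u A
  proof -
    define b where "b = real (card (A - {c}))"
    have fin: "finite A" using A assms(1) by (auto intro: finite_subset)
    \<comment> \<open>There are only \<open>N - 2\<close> other leaves. This yields the factor
      \<open>N - 1\<close> as the largest value of \<open>b + 1\<close>.\<close>
    have "card (A - {c}) \<le> card (V - {u} - {c})"
      using A assms(1) by (intro card_mono) auto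
    also have "\<dots> = N - 2"
      using u assms(1,2,4) by (simp add: card_Diff_singleton_if)
    finally have b: "0 \<le> b" "b + 1 \<le> real N - 1"
      using N by (auto simp: b_def)
    have star: "(star_strategy V c)(u := {}) = star_strategy V c"
      using u by (simp add: fun_eq_iff star_strategy_def)
    from leaf[OF u, of "{}" k] star assms(2)
    have 1: "node_cost V F\<^sub>B f\<^sub>0 (homogeneous_scenario V k) (star_strategy V c) u
        = real k * ((real N - 2) * f\<^sub>0)"
      by simp
    have "real k * f\<^sub>0 * (b + 1) \<le> real k * f\<^sub>0 * (real N - 1)"
      using b assms(6) by (intro mult_left_mono) auto
    \<comment> \<open>This is twice the comparison of gain and price: saved fees
      \<open>k * f\<^sub>0 * b\<close> and revenue \<open>k * f\<^sub>0 * b * (b - 1) / 2\<close>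
      add up to half of the left side.\<close>
    with bound have "b * (real k * f\<^sub>0 * (b + 1)) \<le> b * (2 * F\<^sub>B)"
      using b by (intro mult_left_mono) auto
    \<comment> \<open>If \<open>A\<close> contains \<open>c\<close>, one more channel is paid for
      than \<open>b\<close> counts, which only raises the cost.\<close>
    moreover have "b * F\<^sub>B \<le> real (card A) * F\<^sub>B"
      using fin assms(5) by (intro mult_right_mono) (auto simp: b_def card_mono)
    ultimately show ?thesis
      unfolding 1 leaf[OF u A] assms(2) b_def[symmetric]
      by (simp add: algebra_simps diff_divide_distrib)
  qed
  show ?thesis
    unfolding nash_equilibrium_def strategy_set_def
    using center_stable leaf_stable by (force simp: star_strategy_def not_less)
qed

end
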